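(* Let $k$ be a field of characteristic $p>0$ and let $n\ge1$ be an integer. Then: if $1\le n\le p$, then $\mathfrak{U}_{[n]}^E\leadsto\mathfrak{J}_{[n]}^E$; and if $n>p$, then $\mathfrak{J}_{[n]}^E=\emptyset$.
   Context: $k[T]$ is the polynomial ring in one variable. $A(T)\in\mathrm{Mat}(n,k[T])$ is exponential if $A(0)=I_n$ and $A(T)A(T')=A(T+T')$ ($T,T'$ indeterminates over $k$). For $S\subset\mathrm{Mat}(n,k[T])$, $S^E$ is the set of exponential matrices in $S$. For subsets $S,S'$ of $\mathrm{Mat}(n,k[T])$, $S\leadsto S'$ means: for every $A(T)\in S$ there is $P\in GL(n,k)$ with $P^{-1}A(T)P\in S'$. $\mathfrak{U}_{[n]}$ is the set of upper triangular matrices $(a_{i,j}(T))\in\mathrm{Mat}(n,k[T])$ with all diagonal entries $1$ and $a_{i,i+1}(T)\ne0$ for all $1\le i\le n-1$. $\nu_n\in\mathrm{Mat}(n,k)$ is the nilpotent matrix with entries $1$ at positions $(i,i+1)$, $1\le i\le n-1$, and $0$ elsewhere. For $n\ge2$, $\mathfrak{J}_{[n]}:=\{I_n+s_1\nu_n+\cdots+s_{n-1}\nu_n^{n-1}\mid s_1,\dots,s_{n-1}\in k[T],\ s_1\ne0\}$; for $n=1$, $\mathfrak{J}_{[1]}:=\{I_1\}$. *)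

theory Defs
  imports
    "Jordan_Normal_Form.Matrix"
    "HOL-Computational_Algebra.Computational_Algebra"
begin

text \<open>
  \<open>k[T]\<close> is \<^typ>\<open>'k poly\<close>, and \<open>Mat(n,k[T])\<close> is \<^term>\<open>carrier_mat n n :: 'k::field poly mat set\<close>.
  Matrix indices start at \<open>0\<close>.
\<close>

text \<open>
  The ring \<open>k[T,T']\<close> is \<^typ>\<open>'k poly poly\<close>, with \<open>T\<close> the variable of the inner and \<open>T'\<close> the
  variable of the outer polynomials. For \<open>x\<close> in \<open>k[T,T']\<close>, \<open>subst_mat x A\<close> is \<open>A(x)\<close>: the
  coefficients are embedded as constants of \<open>k[T,T']\<close> and the variable is replaced by \<open>x\<close>.
\<close>

definition var_T :: "'k::field poly poly" where
  "var_T = [:[:0, 1:]:]"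

definition var_T' :: "'k::field poly poly" where
  "var_T' = [:0, 1:]"

definition subst_mat :: "'k::field poly poly \<Rightarrow> 'k poly mat \<Rightarrow> 'k poly poly mat" where
  "subst_mat x A = map_mat (\<lambda>a. poly (map_poly (\<lambda>c. [:[:c:]:]) a) x) A"

definition exponential :: "nat \<Rightarrow> 'k::field poly mat \<Rightarrow> bool" where
  "exponential n A \<longleftrightarrow> A \<in> carrier_mat n n \<and>
     map_mat (\<lambda>a. poly a 0) A = 1\<^sub>m n \<and>
     subst_mat var_T A * subst_mat var_T' A = subst_mat (var_T + var_T') A"

definition exp_part :: "nat \<Rightarrow> 'k::field poly mat set \<Rightarrow> 'k poly mat set" where
  "exp_part n S = {A \<in> S. exponential n A}"

definition const_mat :: "'k::field mat \<Rightarrow> 'k poly mat" where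
  "const_mat M = map_mat (\<lambda>c. [:c:]) M"

definition GL :: "nat \<Rightarrow> 'k::field mat set" where
  "GL n = Units (ring_mat TYPE('k) n ())"

definition GL_inv :: "nat \<Rightarrow> 'k::field mat \<Rightarrow> 'k mat" where
  "GL_inv n P = inv\<^bsub>ring_mat TYPE('k) n ()\<^esub> P"

definition leadsto :: "nat \<Rightarrow> 'k::field poly mat set \<Rightarrow> 'k poly mat set \<Rightarrow> bool" where
  "leadsto n S S' \<longleftrightarrow>
     (\<forall>A\<in>S. \<exists>P\<in>GL n. const_mat (GL_inv n P) * A * const_mat P \<in> S')"

definition frak_U :: "nat \<Rightarrow> 'k::field poly mat set" where
  "frak_U n = {A \<in> carrier_mat n n. upper_triangular A \<and>
     (\<forall>i<n. A $$ (i, i) = 1) \<and> (\<forall>i. i + 1 < n \<longrightarrow> A $$ (i, i + 1) \<noteq> 0)}"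

definition nu :: "nat \<Rightarrow> 'k::field mat" where
  "nu n = mat n n (\<lambda>(i, j). if j = i + 1 then 1 else 0)"

definition frak_J :: "nat \<Rightarrow> 'k::field poly mat set" where
  "frak_J n = (if n = 1 then {1\<^sub>m 1} else
     {1\<^sub>m n + (\<Oplus>\<^bsub>module_mat TYPE('k poly) n n\<^esub>m\<in>{1..n - 1}. s m \<cdot>\<^sub>m const_mat (nu n ^\<^sub>m m)) | s. s 1 \<noteq> 0})"

end

(*
  The identity A(T) A(T') = A(T + T') makes the coefficient matrices of A commute. If A lies in U_[n],
  some coefficient matrix N is then strictly upper triangular with a nowhere vanishing
  superdiagonal, hence conjugate to nu_n over k. After this conjugation A commutes with nu_n, so it
  is a Toeplitz matrix, i.e. a polynomial in nu_n. For n > p, an exponential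
  A = I + s_1 nu_n + ... would satisfy A^p = A(p T) = A(0) = I, whereas the entry of A^p at
  position (0, p) is s_1^p by the Frobenius identity.
*)

theory Submission
  imports Defs "Jordan_Normal_Form.Determinant"
begin

lemma mult_mat_entry:
  assumes "A \<in> carrier_mat n n" "B \<in> carrier_mat n n" "i < n" "j < n"
  shows "(A * B) $$ (i, j) = (\<Sum>l<n. A $$ (i, l) * B $$ (l, j))"
  using assms by (auto simp: scalar_prod_def lessThan_atLeast0)

subsection \<open>Toeplitz matrices\<close>

text \<open>The diagonals are given by a function on the naturals, so that both
  \<open>coeff f\<close> and the first row of a matrix can be inserted for \<open>c\<close>; the
  matrix shows the values \<open>c 0\<close> to \<open>c (n - 1)\<close>.\<close>

definition toeplitz :: "nat \<Rightarrow> (nat \<Rightarrow> 'a::zero) \<Rightarrow> 'a mat" where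
  "toeplitz n c = mat n n (\<lambda>(i, j). if i \<le> j then c (j - i) else 0)"

lemma toeplitz_carrier [simp]: "toeplitz n c \<in> carrier_mat n n"
  by (simp add: toeplitz_def)

lemma toeplitz_index [simp]:
  "i < n \<Longrightarrow> j < n \<Longrightarrow> toeplitz n c $$ (i, j) = (if i \<le> j then c (j - i) else 0)"
  by (simp add: toeplitz_def)

lemma toeplitz_dim [simp]: "dim_row (toeplitz n c) = n" "dim_col (toeplitz n c) = n"
  by (simp_all add: toeplitz_def)

text \<open>The polynomial variable stands for the shift \<open>nu n\<close>: in the entry at (i, j)
  only the indices between i and j survive, and these form the convolution that defines the
  coefficients of \<open>f * g\<close>. Powers of Toeplitz matrices thus reduce to powers of
  polynomials.\<close>

lemma toeplitz_mult:
  fixes f g :: "'a::comm_semiring_1 poly"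
  shows "toeplitz n (coeff f) * toeplitz n (coeff g) = toeplitz n (coeff (f * g))"
proof (rule eq_matI)
  fix i j assume ij: "i < dim_row (toeplitz n (coeff (f * g)))" "j < dim_col (toeplitz n (coeff (f * g)))"
  then have ij: "i < n" "j < n" by auto
  have "(toeplitz n (coeff f) * toeplitz n (coeff g)) $$ (i, j)
      = (\<Sum>l<n. toeplitz n (coeff f) $$ (i, l) * toeplitz n (coeff g) $$ (l, j))"
    by (rule mult_mat_entry) (use ij in auto)
  also have "\<dots> = (\<Sum>l\<in>{i..j}. coeff f (l - i) * coeff g (j - l))"
    by (rule sum.mono_neutral_cong_right) (use ij in auto)
  also have "\<dots> = (if i \<le> j then coeff (f * g) (j - i) else 0)"
  proof (cases "i \<le> j")
    case True
    have "(\<Sum>l\<in>{i..j}. coeff f (l - i) * coeff g (j - l))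
        = (\<Sum>m\<le>j - i. coeff f m * coeff g (j - i - m))"
      by (rule sum.reindex_bij_witness[of _ "\<lambda>m. m + i" "\<lambda>l. l - i"]) (use True in auto)
    then show ?thesis using True by (simp add: coeff_mult)
  qed auto
  finally show "(toeplitz n (coeff f) * toeplitz n (coeff g)) $$ (i, j)
      = toeplitz n (coeff (f * g)) $$ (i, j)" using ij by simp
qed auto

lemma toeplitz_one: "toeplitz n (coeff 1) = 1\<^sub>m n"
  by (rule eq_matI) (simp_all add: of_bool_def)

lemma toeplitz_power:
  fixes f :: "'a::comm_semiring_1 poly"
  shows "toeplitz n (coeff f) ^\<^sub>m m = toeplitz n (coeff (f ^ m))"
proof (induction m)
  case 0
  show ?case by (simp only: pow_mat.simps power_0 toeplitz_one toeplitz_dim)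
qed (simp add: toeplitz_mult mult.commute)

text \<open>Multiplying by \<open>nu n\<close> on the left shifts the rows up, on the right it
  shifts the columns to the right. Equality makes the entries constant along diagonals
  (\<open>shift\<close>) and kills the first column below the corner (\<open>col0\<close>).\<close>

lemma commute_nu_imp_toeplitz:
  fixes B :: "'a::field poly mat"
  assumes B: "B \<in> carrier_mat n n" and comm: "const_mat (nu n) * B = B * const_mat (nu n)"
  shows "B = toeplitz n (\<lambda>m. B $$ (0, m))"
proof -
  let ?\<nu> = "const_mat (nu n) :: 'a poly mat"
  have \<nu>: "?\<nu> \<in> carrier_mat n n" by (simp add: const_mat_def nu_def)
  have \<nu>_ij: "?\<nu> $$ (i, j) = (if j = i + 1 then 1 else 0)" if "i < n" "j < n" for i j
    using that by (simp add: const_mat_def nu_def)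
  have left: "(?\<nu> * B) $$ (i, j) = (if i + 1 < n then B $$ (i + 1, j) else 0)"
    if ij: "i < n" "j < n" for i j
  proof -
    have "(?\<nu> * B) $$ (i, j) = (\<Sum>l<n. if i + 1 = l then B $$ (l, j) else 0)"
      unfolding mult_mat_entry[OF \<nu> B ij] by (rule sum.cong) (auto simp: \<nu>_ij ij)
    then show ?thesis by (simp add: sum.delta)
  qed
  have right: "(B * ?\<nu>) $$ (i, j) = (if j = 0 then 0 else B $$ (i, j - 1))"
    if ij: "i < n" "j < n" for i j
  proof -
    \<comment> \<open>For j = 0 the index \<open>j - 1\<close> is again 0, so the inner conditional
      has to remove this term.\<close>
    have "(B * ?\<nu>) $$ (i, j) = (\<Sum>l<n. if l = j - 1 then (if j = 0 then 0 else B $$ (i, l)) else 0)"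
      unfolding mult_mat_entry[OF B \<nu> ij] by (rule sum.cong) (auto simp: \<nu>_ij ij)
    then show ?thesis using ij by (simp add: sum.delta)
  qed
  have shift: "B $$ (Suc i, Suc j) = B $$ (i, j)" if "Suc i < n" "Suc j < n" for i j
    using left[of i "Suc j"] right[of i "Suc j"] comm that by simp
  have col0: "B $$ (Suc i, 0) = 0" if "Suc i < n" for i
    using left[of i 0] right[of i 0] comm that by simp
  have "B $$ (i, j) = (if i \<le> j then B $$ (0, j - i) else 0)" if "i < n" "j < n" for i j
    using that
  proof (induction i arbitrary: j)
    case (Suc i)
    then show ?case by (cases j) (auto simp: shift col0)
  qed simp
  with B show ?thesis by (intro eq_matI) auto
qed

section \<open>Powers of nu_n and the shape of J_[n]\<close>

lemma nu_power: "(nu n :: 'a::field mat) ^\<^sub>m m = mat n n (\<lambda>(i, j). if j = i + m then 1 else 0)"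
proof (induction m)
  case 0
  show ?case by (intro eq_matI) (auto simp: nu_def)
next
  case (Suc m)
  have c: "mat n n (\<lambda>(i, j). if j = i + m then 1 else 0) \<in> carrier_mat n n"
    "nu n \<in> carrier_mat n n"
    by (auto simp: nu_def)
  have "(mat n n (\<lambda>(i, j). if j = i + m then 1 else (0::'a)) * nu n) $$ (i, j) = (if j = i + Suc m then 1 else 0)"
    if ij: "i < n" "j < n" for i j
  proof -
    have "(mat n n (\<lambda>(i, j). if j = i + m then 1 else (0::'a)) * nu n) $$ (i, j)
       = (\<Sum>l<n. if l = i + m then if j = i + Suc m then 1 else 0 else 0)"
      unfolding mult_mat_entry[OF c ij] by (rule sum.cong) (auto simp: nu_def ij)
    then show ?thesis using ij by (simp add: sum.delta)
  qed
  moreover have "(nu n :: 'a mat) ^\<^sub>m Suc m = mat n n (\<lambda>(i, j). if j = i + m then 1 else 0) * nu n"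
    by (simp add: Suc)
  ultimately show ?case using c by (intro eq_matI) auto
qed

text \<open>Translates the sum in the matrix module, as used by \<open>frak_J\<close>, into sums of
  entries. Carrier and entry are treated together because the entry of a matrix sum is only
  available once the dimensions are known.\<close>

lemma finsum_module_mat_index:
  fixes M :: "'b \<Rightarrow> 'a::comm_ring_1 mat"
  assumes "finite I" and "\<And>m. m \<in> I \<Longrightarrow> M m \<in> carrier_mat n n" and ij: "i < n" "j < n"
  shows "(\<Oplus>\<^bsub>module_mat TYPE('a) n n\<^esub>m\<in>I. M m) \<in> carrier_mat n n \<and>
    (\<Oplus>\<^bsub>module_mat TYPE('a) n n\<^esub>m\<in>I. M m) $$ (i, j) = (\<Sum>m\<in>I. M m $$ (i, j))"
  using assms(1,2)
proof (induction I rule: finite_induct)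
  interpret abelian_group "module_mat TYPE('a) n n" by (rule abelian_group_mat)
  case empty
  show ?case using ij by (simp add: module_mat_simps)
next
  interpret abelian_group "module_mat TYPE('a) n n" by (rule abelian_group_mat)
  case (insert x F)
  then have c: "M \<in> F \<rightarrow> carrier (module_mat TYPE('a) n n)" "M x \<in> carrier (module_mat TYPE('a) n n)"
    by (auto simp: module_mat_simps)
  from insert have IH: "(\<Oplus>\<^bsub>module_mat TYPE('a) n n\<^esub>m\<in>F. M m) \<in> carrier_mat n n"
    "(\<Oplus>\<^bsub>module_mat TYPE('a) n n\<^esub>m\<in>F. M m) $$ (i, j) = (\<Sum>m\<in>F. M m $$ (i, j))"
    by auto
  show ?case
    unfolding finsum_insert[OF insert(1,2) c] using IH insert ij
    by (auto simp: module_mat_simps)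
qed

text \<open>The m-th power of \<open>nu n\<close> has its ones exactly on the m-th superdiagonal, so
  the sum places \<open>s m\<close> there.\<close>

lemma frak_J_eq_toeplitz:
  assumes "n \<ge> 2"
  shows "frak_J n = {toeplitz n c | c. c 0 = 1 \<and> c 1 \<noteq> (0 :: 'a::field poly)}"
proof -
  let ?S = "\<lambda>s :: nat \<Rightarrow> 'a poly. 1\<^sub>m n + (\<Oplus>\<^bsub>module_mat TYPE('a poly) n n\<^esub>m\<in>{1..n - 1}.
    s m \<cdot>\<^sub>m const_mat (nu n ^\<^sub>m m))"
  \<comment> \<open>The sum starts at m = 1, so index 0 is free to record the identity
    summand.\<close>
  have S: "?S s = toeplitz n (s(0 := 1))" for s
  proof -
    let ?M = "\<lambda>m. s m \<cdot>\<^sub>m const_mat (nu n ^\<^sub>m m)"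
    have M: "?M m \<in> carrier_mat n n" for m
      by (simp add: const_mat_def nu_power)
    have F: "(\<Oplus>\<^bsub>module_mat TYPE('a poly) n n\<^esub>m\<in>{1..n - 1}. ?M m) \<in> carrier_mat n n"
      using finsum_module_mat_index[of "{1..n - 1}" ?M n 0 0] M assms by auto
    have "?S s $$ (i, j) = toeplitz n (s(0 := 1)) $$ (i, j)" if ij: "i < n" "j < n" for i j
    proof -
      have "(\<Sum>m\<in>{1..n - 1}. ?M m $$ (i, j)) = (\<Sum>m\<in>{1..n - 1}. if m = j - i then if i < j then s m else 0 else 0)"
        by (rule sum.cong) (use ij in \<open>auto simp: const_mat_def nu_power\<close>)
      also have "\<dots> = (if i < j then s (j - i) else 0)"
        using ij by (auto simp: sum.delta)
      finally show ?thesis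
        using finsum_module_mat_index[of "{1..n - 1}" ?M n i j] M F ij by auto
    qed
    then show ?thesis using F by (intro eq_matI) auto
  qed
  have "frak_J n = {?S s | s. s 1 \<noteq> 0}" using assms by (simp add: frak_J_def)
  also have "\<dots> = {toeplitz n c | c. c 0 = 1 \<and> c 1 \<noteq> 0}"
    unfolding S
  proof (intro equalityI subsetI)
    fix x assume "x \<in> {toeplitz n (s(0 := 1)) | s. s 1 \<noteq> (0::'a poly)}"
    then obtain s where "x = toeplitz n (s(0 := 1))" "s 1 \<noteq> 0" by blast
    then show "x \<in> {toeplitz n c | c. c 0 = 1 \<and> c 1 \<noteq> 0}"
      by (auto intro!: exI[of _ "s(0 := 1)"])
  next
    fix x assume "x \<in> {toeplitz n c | c. c 0 = 1 \<and> c 1 \<noteq> (0::'a poly)}"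
    then obtain c where "x = toeplitz n c" "c 0 = 1" "c 1 \<noteq> 0" by blast
    then show "x \<in> {toeplitz n (s(0 := 1)) | s. s 1 \<noteq> 0}"
      by (auto intro!: exI[of _ c] simp: fun_upd_idem)
  qed
  finally show ?thesis .
qed

subsection \<open>Exponential matrices\<close>

lemma poly_subst_const: "poly (map_poly (\<lambda>c. [:[:c:]:]) [:c:]) x = [:[:c:]:]"
  by (cases "c = 0") (simp_all add: map_poly_pCons)

lemma poly_subst_pCons:
  "poly (map_poly (\<lambda>c. [:[:c:]:]) (pCons c a)) x = [:[:c:]:] + x * poly (map_poly (\<lambda>c. [:[:c:]:]) a) x"
  by (simp add: map_poly_pCons)

text \<open>Being a homomorphism lets the substitution pass through matrix products.
  Multiplicativity follows by induction on the first factor, which splits off a scalar multiple of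
  the second.\<close>

lemma subst_semiring_hom:
  "semiring_hom (\<lambda>a. poly (map_poly (\<lambda>c. [:[:c:]:]) a) (x :: 'k::field poly poly))"
proof -
  let ?s = "\<lambda>a. poly (map_poly (\<lambda>c::'k. [:[:c:]:]) a) x"
  have add: "?s (a + b) = ?s a + ?s b" for a b
  proof (induction a b rule: poly_induct2)
    case (pCons c a d b)
    then show ?case
      unfolding add_pCons poly_subst_pCons by (simp add: algebra_simps)
  qed simp
  have smult: "?s (smult c b) = [:[:c:]:] * ?s b" for c b
  proof (induction b)
    case (pCons d b)
    then show ?case
      unfolding smult_pCons poly_subst_pCons by (simp add: algebra_simps)
  qed simp
  have mult: "?s (a * b) = ?s a * ?s b" for a b
  proof (induction a)
    case (pCons c a)
    then show ?case
      unfolding mult_pCons_left add smult poly_subst_pCons by (simp add: algebra_simps)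
  qed simp
  show ?thesis
    by standard (simp_all add: add mult poly_subst_const[of 1, folded one_pCons] one_pCons[symmetric])
qed

text \<open>Since a(T) is constant in T' and the T'-coefficients of b(T') are constant in T, the
  coefficient of T^d T'^e in a(T) b(T') is \<open>coeff a d * coeff b e\<close>.\<close>

lemma subst_var_T: "poly (map_poly (\<lambda>c. [:[:c:]:]) a) var_T = [:a:]"
proof (induction a)
  case (pCons c a)
  show ?case unfolding poly_subst_pCons pCons by (simp add: var_T_def)
qed simp

lemma coeff_subst_var_T': "coeff (poly (map_poly (\<lambda>c. [:[:c:]:]) a) var_T') e = [:coeff a e:]"
proof (induction a arbitrary: e)
  case (pCons c a)
  show ?case unfolding poly_subst_pCons by (cases e) (simp_all add: var_T'_def pCons(2)[unfolded var_T'_def])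
qed simp

text \<open>Swapping T and T' fixes T + T'. In the Horner induction, multiplication by T + T' raises
  one of the two exponents at a time; the case split handles exponent 0.\<close>

lemma coeff_subst_var_T_plus_var_T'_sym:
  fixes a :: "'k::field poly"
  shows "coeff (coeff (poly (map_poly (\<lambda>c. [:[:c:]:]) a) (var_T + var_T')) d) e
    = coeff (coeff (poly (map_poly (\<lambda>c. [:[:c:]:]) a) (var_T + var_T')) e) d"
proof (induction a arbitrary: d e)
  case (pCons c a)
  show ?case
    unfolding poly_subst_pCons
    using pCons(2) by (cases d; cases e) (simp_all add: var_T_def var_T'_def)
qed simp

text \<open>The coefficient matrices commute: comparing coefficients of T^d T'^e in A(T) A(T') = A(T
  + T') gives their product on the left and something symmetric in d and e on the right.\<close>

lemma exponential_commute_coeff: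
  fixes A :: "'k::field poly mat"
  assumes "exponential n A" and ij: "i < n" "j < n"
  shows "(\<Sum>l<n. coeff (A $$ (i, l)) d * coeff (A $$ (l, j)) e)
       = (\<Sum>l<n. coeff (A $$ (i, l)) e * coeff (A $$ (l, j)) d)"
proof -
  have A: "A \<in> carrier_mat n n"
    and exp: "subst_mat var_T A * subst_mat var_T' A = subst_mat (var_T + var_T') A"
    using assms(1) by (auto simp: exponential_def)
  have c: "subst_mat x A \<in> carrier_mat n n" for x using A by (simp add: subst_mat_def)
  \<comment> \<open>The outer coefficient belongs to T', hence e is extracted before d.\<close>
  have key: "(\<Sum>l<n. coeff (A $$ (i, l)) d * coeff (A $$ (l, j)) e)
      = coeff (coeff (poly (map_poly (\<lambda>c. [:[:c:]:]) (A $$ (i, j))) (var_T + var_T')) e) d" for d e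
  proof -
    have "poly (map_poly (\<lambda>c. [:[:c:]:]) (A $$ (i, j))) (var_T + var_T')
        = (subst_mat var_T A * subst_mat var_T' A) $$ (i, j)"
      unfolding exp using A ij by (simp add: subst_mat_def)
    also have "\<dots> = (\<Sum>l<n. [:A $$ (i, l):] * poly (map_poly (\<lambda>c. [:[:c:]:]) (A $$ (l, j))) var_T')"
      unfolding mult_mat_entry[OF c c ij]
      by (rule sum.cong) (use A ij in \<open>auto simp: subst_mat_def subst_var_T\<close>)
    finally show ?thesis
      by (simp add: coeff_sum coeff_subst_var_T' mult.commute)
  qed
  show ?thesis unfolding key by (rule coeff_subst_var_T_plus_var_T'_sym)
qed

lemma exponential_conjugate:
  fixes A :: "'k::field poly mat"
  assumes "exponential n A" and P: "P \<in> carrier_mat n n" and Q: "Q \<in> carrier_mat n n"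
    and PQ: "P * Q = 1\<^sub>m n" and QP: "Q * P = 1\<^sub>m n"
  shows "exponential n (const_mat Q * A * const_mat P)"
proof -
  have A: "A \<in> carrier_mat n n"
    and A0: "map_mat (\<lambda>a. poly a 0) A = 1\<^sub>m n"
    and exp: "subst_mat var_T A * subst_mat var_T' A = subst_mat (var_T + var_T') A"
    using assms(1) by (auto simp: exponential_def)
  let ?B = "const_mat Q * A * const_mat P"
  have cP: "const_mat P \<in> carrier_mat n n" and cQ: "const_mat Q \<in> carrier_mat n n"
    using P Q by (auto simp: const_mat_def)
  have QA: "const_mat Q * A \<in> carrier_mat n n" using cQ A by auto
  interpret e0: semiring_hom "\<lambda>a::'k poly. poly a 0"
    by standard auto
  have const0: "map_mat (\<lambda>a. poly a 0) (const_mat M) = M" for M :: "'k mat"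
    by (intro eq_matI) (auto simp: const_mat_def)
  have B0: "map_mat (\<lambda>a. poly a 0) ?B = 1\<^sub>m n"
    unfolding e0.mat_hom_mult[OF QA cP] e0.mat_hom_mult[OF cQ A] const0 A0
    using P Q QP by simp
  \<comment> \<open>\<open>D M\<close> is the constant matrix M over k[T,T']; every substitution
    sends \<open>const_mat M\<close> to it.\<close>
  define D where "D M = map_mat (\<lambda>c::'k. [:[:c:]:]) M" for M
  have sc: "subst_mat x (const_mat M) = D M" for x :: "'k poly poly" and M :: "'k mat"
    by (intro eq_matI) (auto simp: const_mat_def subst_mat_def D_def poly_subst_const)
  have sB: "subst_mat x ?B = D Q * subst_mat x A * D P" for x :: "'k poly poly"
  proof -
    interpret s: semiring_hom "\<lambda>a. poly (map_poly (\<lambda>c. [:[:c:]:]) a) x"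
      by (rule subst_semiring_hom)
    show ?thesis
      using s.mat_hom_mult[OF QA cP] s.mat_hom_mult[OF cQ A]
      by (simp add: subst_mat_def[symmetric] sc)
  qed
  interpret d: semiring_hom "\<lambda>c::'k. [:[:c:]:]"
    by standard (simp_all add: one_pCons)
  have DPQ: "D P * D Q = 1\<^sub>m n"
    unfolding D_def d.mat_hom_mult[OF P Q, symmetric] PQ by (rule d.mat_hom_one)
  have c: "D P \<in> carrier_mat n n" "D Q \<in> carrier_mat n n" "\<And>x. subst_mat x A \<in> carrier_mat n n"
    using P Q A by (auto simp: D_def subst_mat_def)
  \<comment> \<open>The inner constants meet as P Q = I and cancel.\<close>
  have "subst_mat var_T ?B * subst_mat var_T' ?B
      = (D Q * subst_mat var_T A) * (D P * D Q) * (subst_mat var_T' A * D P)"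
    unfolding sB using c by (simp add: assoc_mult_mat[where n\<^sub>1=n and n\<^sub>2=n and n\<^sub>3=n and n\<^sub>4=n] mult_carrier_mat[of _ n n _ n])
  also have "\<dots> = D Q * (subst_mat var_T A * subst_mat var_T' A) * D P"
    unfolding DPQ using c by (simp add: right_mult_one_mat[of _ n n] assoc_mult_mat[where n\<^sub>1=n and n\<^sub>2=n and n\<^sub>3=n and n\<^sub>4=n] mult_carrier_mat[of _ n n _ n])
  also have "\<dots> = subst_mat (var_T + var_T') ?B"
    unfolding exp sB ..
  finally show ?thesis
    unfolding exponential_def using B0 QA cP by auto
qed

lemma pow_mat_Suc_left:
  assumes "A \<in> carrier_mat n n"
  shows "A ^\<^sub>m Suc m = A * A ^\<^sub>m m"
proof (induction m)
  case (Suc m)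
  have "A ^\<^sub>m Suc (Suc m) = (A * A ^\<^sub>m m) * A" using Suc by simp
  also have "\<dots> = A * (A ^\<^sub>m m * A)"
    using assms by (intro assoc_mult_mat[of _ n n _ n _ n]) auto
  finally show ?case by simp
qed (use assms in auto)

text \<open>This is A(T)^m = A(mT), by induction from A(T) A(mT) = A((m+1)T), the functional
  equation at T' = mT.\<close>

lemma exponential_power_eq_pcompose:
  fixes A :: "'k::field poly mat"
  assumes "exponential n A"
  shows "A ^\<^sub>m m = map_mat (\<lambda>a. pcompose a [:0, of_nat m:]) A"
proof (induction m)
  have A: "A \<in> carrier_mat n n" and A0: "map_mat (\<lambda>a. poly a 0) A = 1\<^sub>m n"
    using assms by (auto simp: exponential_def)
  {
    case 0
    have "map_mat (\<lambda>a. pcompose a [:0, of_nat 0:]) A = map_mat (\<lambda>c. [:c:]) (map_mat (\<lambda>a. poly a 0) A)"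
      by (intro eq_matI) (auto simp: pcompose_0' poly_0_coeff_0)
    then show ?case unfolding A0 using A by (auto intro!: eq_matI simp: one_pCons)
  next
    case (Suc m)
    \<comment> \<open>Evaluating the outer variable at mT maps k[T,T'] back to k[T].\<close>
    let ?ev = "\<lambda>q :: 'k poly poly. poly q [:0, of_nat m:]"
    let ?sub = "\<lambda>a x. poly (map_poly (\<lambda>c::'k. [:[:c:]:]) a) x"
    interpret ev: semiring_hom ?ev by standard auto
    have ev_sub: "?ev (?sub a x) = pcompose a (?ev x)" for a x
    proof (induction a)
      case (pCons c a)
      then show ?case unfolding poly_subst_pCons by (simp add: pcompose_pCons)
    qed simp
    have "map_mat ?ev (subst_mat x A) = map_mat (\<lambda>a. pcompose a (?ev x)) A" for x
      by (intro eq_matI) (auto simp: subst_mat_def ev_sub)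
    moreover have "?ev var_T = [:0, 1:]" "?ev var_T' = [:0, of_nat m:]"
      "?ev (var_T + var_T') = [:0, of_nat (Suc m):]"
      by (simp_all add: var_T_def var_T'_def)
    moreover have "map_mat (\<lambda>a. pcompose a [:0, 1:]) A = A"
      by (intro eq_matI) auto
    moreover have "map_mat ?ev (subst_mat var_T A) * map_mat ?ev (subst_mat var_T' A)
        = map_mat ?ev (subst_mat (var_T + var_T') A)"
      using assms A ev.mat_hom_mult[of "subst_mat var_T A" n n "subst_mat var_T' A" n]
      by (simp add: exponential_def subst_mat_def)
    ultimately have "A * map_mat (\<lambda>a. pcompose a [:0, of_nat m:]) A
        = map_mat (\<lambda>a. pcompose a [:0, of_nat (Suc m):]) A"
      by simp
    moreover have "A ^\<^sub>m Suc m = A * A ^\<^sub>m m"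
      using A by (rule pow_mat_Suc_left)
    ultimately show ?case using Suc by simp
  }
qed

subsection \<open>Nilpotent matrices with a single Jordan block\<close>

text \<open>Each factor moves the support up by at least one diagonal; on the m-th superdiagonal the
  entry is a product of m consecutive superdiagonal entries of N.\<close>

lemma strictly_upper_triangular_power:
  fixes N :: "'a::field mat"
  assumes N: "N \<in> carrier_mat n n"
    and zero: "\<And>i j. i < n \<Longrightarrow> j < n \<Longrightarrow> j \<le> i \<Longrightarrow> N $$ (i, j) = 0"
    and nz: "\<And>i. i + 1 < n \<Longrightarrow> N $$ (i, i + 1) \<noteq> 0"
  shows "(\<forall>i<n. \<forall>j<n. j < i + m \<longrightarrow> (N ^\<^sub>m m) $$ (i, j) = 0) \<and>
    (\<forall>i. i + m < n \<longrightarrow> (N ^\<^sub>m m) $$ (i, i + m) \<noteq> 0)"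
proof (induction m)
  case 0
  show ?case using N by auto
next
  case (Suc m)
  have c: "N ^\<^sub>m m \<in> carrier_mat n n" using N by simp
  have entry: "(N ^\<^sub>m Suc m) $$ (i, j) = (\<Sum>l<n. (N ^\<^sub>m m) $$ (i, l) * N $$ (l, j))"
    if "i < n" "j < n" for i j
    using mult_mat_entry[OF c N that] by simp
  have "(N ^\<^sub>m Suc m) $$ (i, j) = 0" if ij: "i < n" "j < n" "j < i + Suc m" for i j
    unfolding entry[OF ij(1,2)]
  proof (rule sum.neutral, rule ballI)
    fix l assume "l \<in> {..<n}"
    then show "(N ^\<^sub>m m) $$ (i, l) * N $$ (l, j) = 0"
      using Suc.IH zero[of l j] ij by (cases "l < i + m") auto
  qed
  moreover have "(N ^\<^sub>m Suc m) $$ (i, i + Suc m) \<noteq> 0" if i: "i + Suc m < n" for i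
  proof -
    \<comment> \<open>For l < i + m the left factor vanishes, for l > i + m the right one.\<close>
    have "(\<Sum>l<n. (N ^\<^sub>m m) $$ (i, l) * N $$ (l, i + Suc m))
        = (\<Sum>l\<in>{i + m}. (N ^\<^sub>m m) $$ (i, l) * N $$ (l, i + Suc m))"
    proof (rule sum.mono_neutral_right)
      show "\<forall>l\<in>{..<n} - {i + m}. (N ^\<^sub>m m) $$ (i, l) * N $$ (l, i + Suc m) = 0"
      proof
        fix l assume "l \<in> {..<n} - {i + m}"
        then show "(N ^\<^sub>m m) $$ (i, l) * N $$ (l, i + Suc m) = 0"
          using Suc.IH zero[of l "i + Suc m"] i by (cases "l < i + m") auto
      qed
    qed (use i in auto)
    then show ?thesis
      using Suc.IH nz[of "i + m"] i by (subst entry) auto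
  qed
  ultimately show ?case by blast
qed

text \<open>The columns of \<open>P\<close> are the Jordan chain of \<open>N\<close> generated by the last basis vector.\<close>

lemma strictly_upper_triangular_conjugate_nu:
  fixes N :: "'a::field mat"
  assumes N: "N \<in> carrier_mat n n"
    and zero: "\<And>i j. i < n \<Longrightarrow> j < n \<Longrightarrow> j \<le> i \<Longrightarrow> N $$ (i, j) = 0"
    and nz: "\<And>i. i + 1 < n \<Longrightarrow> N $$ (i, i + 1) \<noteq> 0"
  obtains P where "P \<in> carrier_mat n n" "upper_triangular P" "\<And>i. i < n \<Longrightarrow> P $$ (i, i) \<noteq> 0"
    "N * P = P * nu n"
proof
  have pow: "(N ^\<^sub>m m) $$ (i, j) = 0" if "i < n" "j < n" "j < i + m" for i j m
    using strictly_upper_triangular_power[OF assms] that by blast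
  have pow': "(N ^\<^sub>m m) $$ (i, i + m) \<noteq> 0" if "i + m < n" for i m
    using strictly_upper_triangular_power[OF assms] that by blast
  define P where "P = mat n n (\<lambda>(i, j). (N ^\<^sub>m (n - 1 - j)) $$ (i, n - 1))"
  have P_ij: "P $$ (i, j) = (N ^\<^sub>m (n - 1 - j)) $$ (i, n - 1)" if "i < n" "j < n" for i j
    using that by (simp add: P_def)
  show P: "P \<in> carrier_mat n n" by (simp add: P_def)
  show "upper_triangular P" 
  proof (rule upper_triangularI)
    fix i j assume "j < i" "i < dim_row P"
    then show "P $$ (i, j) = 0" using P by (simp add: P_ij pow)
  qed
  \<comment> \<open>The position (i, n - 1) lies on the superdiagonal of number n - 1 - i, which is
    the exponent used in column i.\<close>
  show "P $$ (i, i) \<noteq> 0" if "i < n" for i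
    using pow'[of i "n - 1 - i"] that by (simp add: P_ij)
  have nu: "(nu n :: 'a mat) \<in> carrier_mat n n" by (simp add: nu_def)
  have "(N * P) $$ (i, j) = (P * nu n) $$ (i, j)" if ij: "i < n" "j < n" for i j
  proof -
    have c: "N ^\<^sub>m (n - 1 - j) \<in> carrier_mat n n" using N by simp
    have "(N * P) $$ (i, j) = (N ^\<^sub>m Suc (n - 1 - j)) $$ (i, n - 1)"
      unfolding pow_mat_Suc_left[OF N] mult_mat_entry[OF N P ij]
      using ij by (subst mult_mat_entry[OF N c]) (auto simp: P_ij)
    \<comment> \<open>N sends column j of P to column j - 1; column 0 is sent to the last column of
      N^n = 0.\<close>
    also have "\<dots> = (if j = 0 then 0 else P $$ (i, j - 1))"
    proof (cases "j = 0")
      case True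
      then show ?thesis using pow[of i "n - 1" "Suc (n - 1 - j)"] ij by simp
    next
      case False
      then have "Suc (n - 1 - j) = n - 1 - (j - 1)" using ij by auto
      with False show ?thesis using ij by (simp only: P_ij) (simp add: P_ij)
    qed
    also have "\<dots> = (\<Sum>l<n. if l = j - 1 then (if j = 0 then 0 else P $$ (i, l)) else 0)"
      using ij less_imp_diff_less by (auto simp: sum.delta)
    also have "\<dots> = (P * nu n) $$ (i, j)"
      unfolding mult_mat_entry[OF P nu ij] by (rule sum.cong) (auto simp: nu_def ij)
    finally show ?thesis .
  qed
  then show "N * P = P * nu n" using N P nu by (intro eq_matI) auto
qed

text \<open>Conjugating a suitable coefficient matrix to \<open>nu n\<close> makes A Toeplitz. That
  the conjugate has diagonal 1 and a nonzero superdiagonal is then read off from its first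
  row.\<close>

lemma exponential_conjugate_frak_J:
  fixes A :: "'k::field poly mat"
  assumes n: "n \<ge> 2" and U: "A \<in> frak_U n" and exp: "exponential n A"
  shows "\<exists>P\<in>GL n. const_mat (GL_inv n P) * A * const_mat P \<in> exp_part n (frak_J n)"
proof -
  have A: "A \<in> carrier_mat n n" and A_diag: "\<And>i. i < n \<Longrightarrow> A $$ (i, i) = 1"
    and A_super: "\<And>i. i + 1 < n \<Longrightarrow> A $$ (i, i + 1) \<noteq> 0"
    and A_low: "\<And>i j. i < n \<Longrightarrow> j < i \<Longrightarrow> A $$ (i, j) = 0"
    using U by (auto simp: frak_U_def)
  have A0: "coeff (A $$ (i, j)) 0 = (if i = j then 1 else 0)" if ij: "i < n" "j < n" for i j
  proof -
    have "map_mat (\<lambda>a. poly a 0) A $$ (i, j) = 1\<^sub>m n $$ (i, j)"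
      using exp by (simp add: exponential_def)
    then show ?thesis using ij A by (simp add: poly_0_coeff_0)
  qed

  \<comment> \<open>The coefficient matrices of A\<close>
  define N where "N e = map_mat (\<lambda>a. coeff a e) A" for e
  have N: "N e \<in> carrier_mat n n" for e using A by (simp add: N_def)
  have N_ij: "N e $$ (i, j) = coeff (A $$ (i, j)) e" if "i < n" "j < n" for e i j
    using A that by (simp add: N_def)
  \<comment> \<open>On the diagonal A has the constant 1, which has no coefficient of positive
    degree.\<close>
  have N_low: "N e $$ (i, j) = 0" if "i < n" "j < n" "j \<le> i" "e > 0" for e i j
    using that A_low[of i j] A_diag[of i] by (cases "i = j") (auto simp: N_ij)
  have N_comm: "(\<Sum>l<n. N d $$ (i, l) * N e $$ (l, j)) = (\<Sum>l<n. N e $$ (i, l) * N d $$ (l, j))"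
    if ij: "i < n" "j < n" for d e i j
    using exponential_commute_coeff[OF exp ij, of d e] ij by (simp add: N_ij)
  obtain e where e: "N e $$ (0, 1) \<noteq> 0"
    using A_super[of 0] n by (auto simp: N_ij poly_eq_iff)
  \<comment> \<open>A(0) = I has a zero at position (0, 1), so degree 0 is excluded.\<close>
  have e_pos: "e > 0" using e n A0[of 0 1] by (cases e) (auto simp: N_ij)
  \<comment> \<open>Commutation makes the superdiagonal entries of \<open>A\<close> constant multiples of one another.\<close>
  have N_super: "N e $$ (i, i + 1) \<noteq> 0" if "i + 1 < n" for i
    using that
  proof (induction i)
    case 0
    show ?case using e by simp
  next
    case (Suc i)
    obtain d where d: "N d $$ (i + 1, i + 2) \<noteq> 0"
      using A_super[of "i + 1"] Suc.prems by (auto simp: N_ij poly_eq_iff)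
    have d_pos: "d > 0" using d Suc.prems A0[of "i + 1" "i + 2"] by (cases d) (auto simp: N_ij)
    \<comment> \<open>Two steps above the diagonal, a product of strictly upper triangular matrices
      has a single surviving term.\<close>
    have middle: "(\<Sum>l<n. N a $$ (i, l) * N b $$ (l, i + 2)) = N a $$ (i, i + 1) * N b $$ (i + 1, i + 2)"
      if "a > 0" "b > 0" for a b
    proof -
      have "(\<Sum>l<n. N a $$ (i, l) * N b $$ (l, i + 2))
          = (\<Sum>l\<in>{i + 1}. N a $$ (i, l) * N b $$ (l, i + 2))"
      proof (rule sum.mono_neutral_right)
        show "\<forall>l\<in>{..<n} - {i + 1}. N a $$ (i, l) * N b $$ (l, i + 2) = 0"
        proof
          fix l assume l: "l \<in> {..<n} - {i + 1}"
          then consider "l \<le> i" | "l \<ge> i + 2" by fastforce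
          then show "N a $$ (i, l) * N b $$ (l, i + 2) = 0"
            using l Suc.prems that N_low[of i l a] N_low[of l "i + 2" b] by cases auto
        qed
      qed (use Suc.prems in auto)
      then show ?thesis by simp
    qed
    \<comment> \<open>The left side is nonzero by the induction hypothesis and the choice of d, so
      the factor of \<open>N e\<close> on the right is nonzero.\<close>
    have "N e $$ (i, i + 1) * N d $$ (i + 1, i + 2) = N d $$ (i, i + 1) * N e $$ (i + 1, i + 2)"
      using N_comm[of i "i + 2" e d] Suc.prems middle d_pos e_pos by simp
    then show ?case using d Suc by auto
  qed

  \<comment> \<open>Conjugation to a Toeplitz matrix\<close>
  obtain P where P: "P \<in> carrier_mat n n" and P_ut: "upper_triangular P"
    and P_diag: "\<And>i. i < n \<Longrightarrow> P $$ (i, i) \<noteq> 0" and NP: "N e * P = P * nu n"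
    using strictly_upper_triangular_conjugate_nu[OF N, of e] N_low e_pos N_super by metis
  have "det P \<noteq> 0"
    using det_upper_triangular[OF P_ut P] P_diag P by (auto simp: diag_mat_def prod_list_zero_iff)
  then have P_GL: "P \<in> GL n"
    unfolding GL_def by (rule det_non_zero_imp_unit[OF P])
  interpret R: ring "ring_mat TYPE('k) n ()" by (rule ring_mat)
  define Q where "Q = GL_inv n P"
  have Q: "Q \<in> carrier_mat n n" and PQ: "P * Q = 1\<^sub>m n" and QP: "Q * P = 1\<^sub>m n"
    using R.Units_inv_closed R.Units_r_inv R.Units_l_inv P_GL
    by (auto simp: Q_def GL_def GL_inv_def ring_mat_simps)
  define B where "B = const_mat Q * A * const_mat P"
  have cc: "const_mat M \<in> carrier_mat n n" if "M \<in> carrier_mat n n" for M :: "'k mat"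
    using that by (simp add: const_mat_def)
  note carr = cc[OF P] cc[OF Q] cc[OF N] A
  have nu: "(nu n :: 'k mat) \<in> carrier_mat n n" by (simp add: nu_def)
  interpret c: semiring_hom "\<lambda>c::'k. [:c:]"
    by standard (simp_all add: one_pCons)
  have const_mult: "const_mat (M * M') = const_mat M * const_mat M'"
    if "M \<in> carrier_mat n n" "M' \<in> carrier_mat n n" for M M' :: "'k mat"
    unfolding const_mat_def using that by (rule c.mat_hom_mult)
  have const_one: "const_mat (1\<^sub>m n :: 'k mat) = 1\<^sub>m n"
    unfolding const_mat_def by (rule c.mat_hom_one)
  note assoc = assoc_mult_mat[of _ n n _ n _ n]
  have B: "B \<in> carrier_mat n n" using carr by (auto simp: B_def)
  have NA: "const_mat (N e) * A = A * const_mat (N e)"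
  proof (rule eq_matI)
    fix i j assume "i < dim_row (A * const_mat (N e))" "j < dim_col (A * const_mat (N e))"
    then have ij: "i < n" "j < n" using A by (auto simp: const_mat_def N_def)
    have const_ij: "const_mat (N e) $$ (i, j) = [:N e $$ (i, j):]" if "i < n" "j < n" for i j
      using N[of e] that by (simp add: const_mat_def)
    have "(const_mat (N e) * A) $$ (i, j) = (\<Sum>l<n. [:N e $$ (i, l):] * A $$ (l, j))"
      unfolding mult_mat_entry[OF carr(3,4) ij] by (rule sum.cong) (auto simp: const_ij ij)
    also have "\<dots> = (\<Sum>l<n. A $$ (i, l) * [:N e $$ (l, j):])"
    proof (rule poly_eqI)
      fix d
      show "coeff (\<Sum>l<n. [:N e $$ (i, l):] * A $$ (l, j)) d
          = coeff (\<Sum>l<n. A $$ (i, l) * [:N e $$ (l, j):]) d"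
        using N_comm[OF ij, of e d] ij by (simp add: coeff_sum N_ij mult.commute)
    qed
    also have "\<dots> = (A * const_mat (N e)) $$ (i, j)"
      unfolding mult_mat_entry[OF carr(4,3) ij] by (rule sum.cong) (auto simp: const_ij ij)
    finally show "(const_mat (N e) * A) $$ (i, j) = (A * const_mat (N e)) $$ (i, j)" .
  qed (use A in \<open>auto simp: const_mat_def N_def\<close>)
  have nuQ: "nu n * Q = Q * N e"
  proof -
    have "nu n * Q = (Q * P) * (nu n * Q)" 
      unfolding QP using left_mult_one_mat[OF mult_carrier_mat[OF nu Q]] by simp
    also have "\<dots> = Q * (P * nu n) * Q" using P Q nu by (simp add: assoc mult_carrier_mat[of _ n n _ n])
    also have "\<dots> = Q * N e * (P * Q)" unfolding NP[symmetric]
      using P Q N by (simp add: assoc mult_carrier_mat[of _ n n _ n])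
    finally show ?thesis unfolding PQ using Q N[of e] right_mult_one_mat[of "Q * N e" n n] by auto
  qed
  \<comment> \<open>\<open>nu n\<close> passes through Q as \<open>N e\<close>, commutes with A, and
    leaves through P as \<open>nu n\<close>.\<close>
  have "const_mat (nu n) * B = const_mat (nu n * Q) * A * const_mat P"
    unfolding B_def const_mult[OF nu Q] using carr cc[OF nu] by (simp add: assoc mult_carrier_mat[of _ n n _ n])
  also have "\<dots> = const_mat Q * (const_mat (N e) * A) * const_mat P"
    unfolding nuQ const_mult[OF Q N] using carr by (simp add: assoc mult_carrier_mat[of _ n n _ n])
  also have "\<dots> = const_mat Q * A * const_mat (N e * P)"
    unfolding NA const_mult[OF N P] using carr by (simp add: assoc mult_carrier_mat[of _ n n _ n])
  also have "\<dots> = B * const_mat (nu n)"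
    unfolding NP const_mult[OF P nu] B_def using carr cc[OF nu] by (simp add: assoc mult_carrier_mat[of _ n n _ n])
  finally have B_toeplitz: "B = toeplitz n (\<lambda>m. B $$ (0, m))"
    using B by (intro commute_nu_imp_toeplitz)
  then have B_ij: "B $$ (i, j) = (if i \<le> j then B $$ (0, j - i) else 0)" if "i < n" "j < n" for i j
    using that by (metis toeplitz_index)

  \<comment> \<open>The first two entries of the Toeplitz matrix\<close>
  have "const_mat P * B = const_mat (P * Q) * A * const_mat P"
    unfolding B_def const_mult[OF P Q] using carr by (simp add: assoc mult_carrier_mat[of _ n n _ n])
  then have PB: "const_mat P * B = A * const_mat P"
    unfolding PQ const_one using A by simp
  have P_ij: "const_mat P $$ (i, j) = [:P $$ (i, j):]" if "i < n" "j < n" for i j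
    using P that by (simp add: const_mat_def)
  have P_low: "P $$ (i, j) = 0" if "j < i" "i < n" for i j
    using P_ut P that by auto
  \<comment> \<open>Row 0 of P B = A P, a form that avoids the entries of Q. Upper triangularity of
    B and P cuts the sums at l = j.\<close>
  have entry: "(\<Sum>l\<le>j. [:P $$ (0, l):] * B $$ (0, j - l)) = (\<Sum>l\<le>j. A $$ (0, l) * [:P $$ (l, j):])"
    if j: "j < n" for j
  proof -
    have "(\<Sum>l\<le>j. [:P $$ (0, l):] * B $$ (0, j - l)) = (\<Sum>l<n. const_mat P $$ (0, l) * B $$ (l, j))"
      by (rule sum.mono_neutral_cong_left) (use j in \<open>auto simp: P_ij B_ij[of _ j]\<close>)
    also have "\<dots> = (\<Sum>l<n. A $$ (0, l) * const_mat P $$ (l, j))"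
      using mult_mat_entry[OF carr(1) B, of 0 j] mult_mat_entry[OF carr(4,1), of 0 j] PB j by simp
    also have "\<dots> = (\<Sum>l\<le>j. A $$ (0, l) * [:P $$ (l, j):])"
      by (rule sum.mono_neutral_cong_right) (use j in \<open>auto simp: P_ij P_low\<close>)
    finally show ?thesis .
  qed
  have "[:P $$ (0, 0):] * B $$ (0, 0) = [:P $$ (0, 0):] * 1"
    using entry[of 0] n A_diag[of 0] by simp
  then have B00: "B $$ (0, 0) = 1"
    using P_diag[of 0] n unfolding mult_cancel_left by simp
  \<comment> \<open>Both sides of \<open>entry\<close> at j = 1 also contain
    \<open>P $$ (0, 1)\<close>, once times \<open>B $$ (0, 0)\<close> and once times
    \<open>A $$ (0, 0)\<close>; both factors are 1, so these terms cancel.\<close>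
  have "[:P $$ (0, 0):] * B $$ (0, 1) = A $$ (0, 1) * [:P $$ (1, 1):]"
    using entry[of 1] n A_diag[of 0] B00 by (simp add: atMost_Suc)
  then have "B $$ (0, 1) \<noteq> 0"
    using P_diag[of 1] A_super[of 0] n by force
  with B_toeplitz B00 have "B \<in> frak_J n"
    unfolding frak_J_eq_toeplitz[OF n] by blast
  moreover have "exponential n B"
    unfolding B_def by (rule exponential_conjugate[OF exp P Q PQ QP])
  ultimately show ?thesis
    using P_GL by (auto simp: exp_part_def B_def Q_def)
qed

subsection \<open>The order of an exponential matrix\<close>

text \<open>A^p is computed in two ways at position (0, p), which exists because n > p: it is 0
  since A^p = A(pT) = I, and \<open>c 1 ^ p\<close> by Frobenius.\<close>

lemma frak_J_not_exponential:
  assumes p: "CHAR('k::field) = p" "p > 0" and n: "n > p" and J: "A \<in> (frak_J n :: 'k poly mat set)"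
  shows "\<not> exponential n A"
proof
  assume exp: "exponential n A"
  have prime: "prime p" using p by (metis prime_CHAR_semidom)
  then have "p \<ge> 2" by (rule prime_ge_2_nat)
  with n have "n \<ge> 2" by simp
  with J obtain c where A: "A = toeplitz n c" and c: "c 0 = 1" "c 1 \<noteq> 0"
    unfolding frak_J_eq_toeplitz[OF \<open>n \<ge> 2\<close>] by blast
  \<comment> \<open>A polynomial version of \<open>c\<close>: f = 1 + X h agrees with
    \<open>c\<close> below n, where the outer variable X now stands for \<open>nu n\<close>, not for
    T'.\<close>
  define h where "h = (\<Sum>i<n. monom (c (Suc i)) i)"
  define f where "f = 1 + pCons 0 h"
  have h: "coeff h i = c (Suc i)" if "i < n" for i
    using that by (simp add: h_def coeff_sum)
  have f: "coeff f i = c i" if "i < n" for i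
    using that c h by (cases i) (auto simp: f_def)
  have A_f: "A = toeplitz n (coeff f)"
    unfolding A by (intro eq_matI) (auto simp: f)
  have shift: "pCons 0 h = monom 1 1 * h"
    by (simp add: monom_Suc monom_0)
  have "CHAR('k poly poly) = p" using p by simp
  then have "f ^ p = 1 ^ p + pCons 0 h ^ p"
    unfolding f_def using prime by (intro freshmans_dream) auto
  also have "\<dots> = 1 + monom 1 p * h ^ p"
    unfolding shift power_mult_distrib monom_power by simp
  \<comment> \<open>In X^p h^p this is the constant coefficient of h^p; the summand 1 contributes
    nothing as p > 0.\<close>
  finally have "coeff (f ^ p) p = c 1 ^ p"
    using h[of 0] n p(2) by (simp add: coeff_monom_mult coeff_0_power)
  then have "(A ^\<^sub>m p) $$ (0, p) = c 1 ^ p"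
    unfolding A_f toeplitz_power using n by simp
  \<comment> \<open>In characteristic p the scalars p and 0 agree, so A(pT) = A(0T).\<close>
  moreover have "(A ^\<^sub>m p) $$ (0, p) = (A ^\<^sub>m 0) $$ (0, p)"
    unfolding exponential_power_eq_pcompose[OF exp] p(1)[symmetric] of_nat_CHAR of_nat_0 ..
  ultimately show False using c n p by (simp add: A)
qed

theorem corollary1p15:
  fixes p n :: nat
  assumes "CHAR('k::field) = p" and "p > 0" and "n \<ge> 1"
  shows "(n \<le> p \<longrightarrow> leadsto n (exp_part n (frak_U n :: 'k poly mat set)) (exp_part n (frak_J n))) \<and>
         (n > p \<longrightarrow> exp_part n (frak_J n :: 'k poly mat set) = {})"
proof (intro conjI impI)
  show "leadsto n (exp_part n (frak_U n :: 'k poly mat set)) (exp_part n (frak_J n))"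
  proof (cases "n = 1")
    case False
    then have "n \<ge> 2" using assms by simp
    then show ?thesis
      unfolding leadsto_def using exponential_conjugate_frak_J[of n] by (auto simp: exp_part_def)
  next
    \<comment> \<open>\<open>frak_J 1\<close> is defined separately; the only member of
      \<open>frak_U 1\<close> is the identity, and conjugation by the identity suffices.\<close>
    case True
    interpret R: ring "ring_mat TYPE('k) n ()" by (rule ring_mat)
    have GL_one: "1\<^sub>m n \<in> (GL n :: 'k mat set)" "GL_inv n (1\<^sub>m n :: 'k mat) = 1\<^sub>m n"
      using R.Units_one_closed R.inv_one by (simp_all add: GL_def GL_inv_def ring_mat_simps)
    have const_one: "const_mat (1\<^sub>m n :: 'k mat) = 1\<^sub>m n"
      by (intro eq_matI) (auto simp: const_mat_def one_pCons)
    show ?thesis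
      unfolding leadsto_def
    proof
      fix A :: "'k poly mat"
      assume "A \<in> exp_part n (frak_U n)"
      then have U: "A \<in> frak_U n" and exp: "exponential n A"
        by (simp_all add: exp_part_def)
      have A: "A = 1\<^sub>m n"
        using U True by (intro eq_matI) (auto simp: frak_U_def)
      have "const_mat (GL_inv n (1\<^sub>m n)) * A * const_mat (1\<^sub>m n) = A"
        unfolding GL_one const_one A by simp
      moreover have "A \<in> frak_J n"
        using A True by (simp add: frak_J_def)
      ultimately show "\<exists>P\<in>GL n. const_mat (GL_inv n P) * A * const_mat P \<in> exp_part n (frak_J n)"
        using GL_one(1) exp by (intro bexI[of _ "1\<^sub>m n"]) (simp_all only: exp_part_def mem_Collect_eq simp_thms)
    qed
  qed
  show "exp_part n (frak_J n :: 'k poly mat set) = {}" if "n > p"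
    using frak_J_not_exponential[OF assms(1,2) that] by (auto simp: exp_part_def)
qed

end
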